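(* Let $S\neq\mathbb{N}$ be a numerical semigroup with maximal ideal $M$, and let $a\in M-2M$. The semigroup $S+a=\{0\}\cup\{m+a\mid m\in M\}$ (the dilatation of $S$ with respect to $a$) is GAS if and only if $S$ is GAS.
   Context: A numerical semigroup is a submonoid $S$ of $(\mathbb{N},+)$ (with $0\in\mathbb{N}$) such that $\mathbb{N}\setminus S$ is finite. It has a unique minimal system of generators, whose elements are its minimal generators. For a numerical semigroup $S$: $F(S)=\max(\mathbb{Z}\setminus S)$ is its Frobenius number, $M=M(S)=S\setminus\{0\}$ is its maximal ideal, and $K=K(S)=\{x\in\mathbb{N}\mid F(S)-x\notin S\}$ is its standard canonical ideal. For sets $X,Y\subseteq\mathbb{Z}$, $X-Y=\{z\in\mathbb{Z}\mid z+Y\subseteq X\}$ and $2X=X+X$; in particular $M-2M=\{a\in\mathbb{Z}\mid a+M+M\subseteq M\}$. For $a\in M-2M$, the set $S+a=\{0\}\cup\{m+a\mid m\in M\}$ is a numerical semigroup, called the dilatation of $S$ with respect to $a$. The set of pseudo-Frobenius numbers of $S$ is $PF(S)=(S-M)\setminus S$. A numerical semigroup $S$ is GAS (generalized almost symmetric) if either $2K=K$ or $2K\setminus K=\{F(S)-x_1,\dots,F(S)-x_r,F(S)\}$ for some $r\ge 0$ and some minimal generators $x_1,\dots,x_r$ of $S$ such that $x_i-x_j\notin PF(S)$ for every $i,j$.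
   Formalization: The formal statement also assumes 0 ∉ M+a, i.e. a ≠ −min M; without this the claim fails: for S = ⟨3,10,11⟩ and a = −3, S+a = ⟨3,7,8⟩ is GAS but S is not. *)

theory Defs
  imports Main "HOL-Library.Set_Algebras"
begin

text \<open>
  Numerical semigroups are represented as sets of integers contained in \<open>\<nat>\<close>, so that the
  relative ideals and differences in \<open>\<int>\<close> need no coercions. On sets, \<open>X + Y\<close> is the Minkowski
  sum and \<open>z +o Y\<close> the translate (from Set_Algebras), so \<open>2X\<close> is \<open>X + X\<close>;
  \<open>X - Y\<close> remains the set-theoretic difference.
\<close>

definition numerical_semigroup :: "int set \<Rightarrow> bool" where
  "numerical_semigroup S \<longleftrightarrow>
     S \<subseteq> \<nat> \<and> 0 \<in> S \<and> (\<forall>x\<in>S. \<forall>y\<in>S. x + y \<in> S) \<and> finite (\<nat> - S)"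

definition generated_submonoid :: "int set \<Rightarrow> int set" where
  "generated_submonoid A = \<Inter>{T. A \<subseteq> T \<and> 0 \<in> T \<and> (\<forall>x\<in>T. \<forall>y\<in>T. x + y \<in> T)}"

definition minimal_generating_system :: "int set \<Rightarrow> int set \<Rightarrow> bool" where
  "minimal_generating_system S A \<longleftrightarrow>
     generated_submonoid A = S \<and> (\<forall>B. B \<subset> A \<longrightarrow> generated_submonoid B \<noteq> S)"

text \<open>For a numerical semigroup the minimal system of generators exists and is unique.\<close>

definition minimal_generators :: "int set \<Rightarrow> int set" where
  "minimal_generators S = (THE A. minimal_generating_system S A)"

text \<open>The maximum of \<open>\<int> \<setminus> S\<close>; this set is infinite, so \<open>Max\<close> does not apply.\<close>

definition frobenius :: "int set \<Rightarrow> int" where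
  "frobenius S = (GREATEST z. z \<notin> S)"

definition maximal_ideal :: "int set \<Rightarrow> int set" where
  "maximal_ideal S = S - {0}"

definition canonical_ideal :: "int set \<Rightarrow> int set" where
  "canonical_ideal S = {x \<in> \<nat>. frobenius S - x \<notin> S}"

text \<open>The difference of relative ideals, written \<open>X - Y\<close> in the literature.\<close>

definition ideal_diff :: "int set \<Rightarrow> int set \<Rightarrow> int set" where
  "ideal_diff X Y = {z. z +o Y \<subseteq> X}"

definition pseudo_frobenius :: "int set \<Rightarrow> int set" where
  "pseudo_frobenius S = ideal_diff S (maximal_ideal S) - S"

text \<open>
  The maximal ideal of the dilatation is \<open>M + a\<close> unless \<open>0 \<in> M + a\<close>. For
  \<open>a \<in> M - 2M\<close> the latter happens only if \<open>a = - min M\<close>. In that case the GAS property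
  need not be preserved: for \<open>S = \<langle>3, 10, 11\<rangle>\<close> and \<open>a = -3\<close> the result \<open>\<langle>3, 7, 8\<rangle>\<close> is
  GAS while \<open>S\<close> is not.
\<close>

definition dilatation :: "int set \<Rightarrow> int \<Rightarrow> int set" where
  "dilatation S a = {0} \<union> {m + a | m. m \<in> maximal_ideal S}"

text \<open>Below, \<open>X\<close> is the set \<open>{x\<^sub>1, \<dots>, x\<^sub>r}\<close>; it is empty when \<open>r = 0\<close>.\<close>

definition GAS :: "int set \<Rightarrow> bool" where
  "GAS S \<longleftrightarrow> numerical_semigroup S \<and>
     (let K = canonical_ideal S; F = frobenius S in
        K + K = K \<or>
        (\<exists>X. finite X \<and> X \<subseteq> minimal_generators S \<and>
             (\<forall>x\<in>X. \<forall>y\<in>X. x - y \<notin> pseudo_frobenius S) \<and>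
             (K + K) - K = {F - x | x. x \<in> X} \<union> {F}))"

end

theory Submission
  imports Defs
begin

text \<open>
  The GAS property of \<open>S\<close> depends on the maximal ideal \<open>M\<close> only up to translation, and the
  maximal ideal of the dilatation is \<open>M + a\<close>.

  To see the first claim, write \<open>z = F - x\<close> for an element of \<open>2K\<close>. Then \<open>z \<notin> K\<close> means
  \<open>x \<in> S\<close>, and \<open>z = (F - u) + (F - v)\<close> with \<open>F - u, F - v \<in> K\<close> means that \<open>u, v\<close> are gaps
  with \<open>u + v = F + x\<close>. So \<open>2K \<setminus> K\<close> is the reflection of a set of elements \<open>x\<close> whose nonzero
  part \<open>E\<close> (\<open>gap_pair_elements\<close> below) is described by \<open>M\<close>, its complement and the maximum of
  the complement. Removing a summand in \<open>M\<close> from an element of \<open>E\<close> leaves an element of \<open>E\<close>.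
  Therefore both requirements in the definition of GAS, that \<open>E\<close> consist of minimal generators
  (of elements of \<open>M \<setminus> 2M\<close>, that is) and that no difference be a pseudo-Frobenius number, are
  summed up in a single one: two distinct elements of \<open>E\<close> never differ by an element of
  \<open>M - M\<close> (\<open>GAS_iff\<close>). Indeed a nonzero element of \<open>M - M\<close> is either in \<open>M\<close>, where the
  first requirement forbids it as a difference, or pseudo-Frobenius, where the second does.

  Replacing \<open>M\<close> by \<open>M + a\<close> replaces \<open>E\<close> by \<open>E + a\<close> and fixes \<open>M - M\<close>, so this criterion
  holds for \<open>S\<close> if and only if it holds for the dilatation.
\<close>

section \<open>The Frobenius number\<close>

lemma frobenius_eqI:
  assumes "z \<notin> S" and "\<And>y. z < y \<Longrightarrow> y \<in> S"
  shows "frobenius S = z"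
  unfolding frobenius_def
  by (rule Greatest_equality) (use assms in \<open>auto intro: leI\<close>)

definition has_last_gap :: "int set \<Rightarrow> bool" where
  "has_last_gap A \<longleftrightarrow> (\<exists>z. z \<notin> A \<and> (\<forall>y>z. y \<in> A))"

lemma
  assumes "has_last_gap A"
  shows frobenius_notin: "frobenius A \<notin> A"
    and above_frobenius_in: "frobenius A < y \<Longrightarrow> y \<in> A"
    and gap_le_frobenius: "y \<notin> A \<Longrightarrow> y \<le> frobenius A"
proof -
  obtain z where z: "z \<notin> A" "\<And>y. z < y \<Longrightarrow> y \<in> A"
    using assms unfolding has_last_gap_def by blast
  then have "frobenius A = z" by (rule frobenius_eqI)
  then show "frobenius A \<notin> A" "frobenius A < y \<Longrightarrow> y \<in> A" "y \<notin> A \<Longrightarrow> y \<le> frobenius A"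
    using z by (auto intro: leI)
qed

lemma has_last_gap_numerical_semigroup:
  assumes "numerical_semigroup S"
  shows "has_last_gap S"
proof -
  \<comment> \<open>The gap \<open>-1\<close> keeps the set nonempty when \<open>S = \<nat>\<close>.\<close>
  let ?G = "insert (-1) (\<nat> - S)"
  have fin: "finite ?G" and sub: "S \<subseteq> \<nat>"
    using assms by (auto simp: numerical_semigroup_def)
  have "(-1::int) \<notin> \<nat>" by (auto elim: Nats_cases)
  then have "Max ?G \<notin> S"
    using Max_in[OF fin] sub by auto
  moreover have "y \<in> S" if "Max ?G < y" for y
  proof (rule ccontr)
    assume "y \<notin> S"
    have "-1 \<le> Max ?G" using fin by simp
    then have "0 \<le> y" using that by linarith
    then have "y \<in> \<nat>" by (simp add: Nats_altdef1)
    then have "y \<le> Max ?G" using fin \<open>y \<notin> S\<close> by simp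
    then show False using that by simp
  qed
  ultimately show ?thesis unfolding has_last_gap_def by blast
qed

lemma frobenius_pos:
  assumes "numerical_semigroup S" "S \<noteq> \<nat>"
  shows "0 < frobenius S"
proof -
  obtain y where y: "y \<in> \<nat>" "y \<notin> S" and "0 \<in> S"
    using assms by (auto simp: numerical_semigroup_def)
  have "0 \<le> y" using y(1) by (simp add: Nats_altdef1)
  moreover have "y \<noteq> 0" using y(2) \<open>0 \<in> S\<close> by auto
  ultimately have "0 < y" by simp
  then show ?thesis
    using gap_le_frobenius[OF has_last_gap_numerical_semigroup[OF assms(1)] y(2)] by simp
qed

lemma has_last_gap_maximal_ideal:
  assumes "numerical_semigroup S"
  shows "has_last_gap (maximal_ideal S)"
proof -
  obtain z where "z \<notin> S" "\<forall>y>z. y \<in> S"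
    using has_last_gap_numerical_semigroup[OF assms] by (auto simp: has_last_gap_def)
  then have "max z 0 \<notin> maximal_ideal S \<and> (\<forall>y>max z 0. y \<in> maximal_ideal S)"
    by (auto simp: maximal_ideal_def max_def)
  then show ?thesis unfolding has_last_gap_def by blast
qed

lemma frobenius_maximal_ideal:
  assumes "numerical_semigroup S" "S \<noteq> \<nat>"
  shows "frobenius (maximal_ideal S) = frobenius S"
proof (rule frobenius_eqI)
  note gap = has_last_gap_numerical_semigroup[OF assms(1)]
  show "frobenius S \<notin> maximal_ideal S"
    using frobenius_notin[OF gap] by (simp add: maximal_ideal_def)
  show "y \<in> maximal_ideal S" if "frobenius S < y" for y
    using above_frobenius_in[OF gap that] frobenius_pos[OF assms] that
    by (simp add: maximal_ideal_def)
qed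

lemma frobenius_translate:
  assumes "has_last_gap A"
  shows "frobenius (a +o A) = a + frobenius A"
proof (rule frobenius_eqI)
  show "a + frobenius A \<notin> a +o A"
    using frobenius_notin[OF assms] by (auto simp: elt_set_plus_def)
  show "y \<in> a +o A" if "a + frobenius A < y" for y
    using above_frobenius_in[OF assms, of "y - a"] that
      set_plus_intro2[of "y - a" A a] by simp
qed


section \<open>Minimal generators\<close>

lemma generated_submonoid_least:
  assumes "A \<subseteq> T" "0 \<in> T" "\<And>x y. x \<in> T \<Longrightarrow> y \<in> T \<Longrightarrow> x + y \<in> T"
  shows "generated_submonoid A \<subseteq> T"
  using assms unfolding generated_submonoid_def by blast

lemma generated_submonoid_superset: "A \<subseteq> generated_submonoid A"
  and generated_submonoid_zero: "0 \<in> generated_submonoid A"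
  and generated_submonoid_add:
    "x \<in> generated_submonoid A \<Longrightarrow> y \<in> generated_submonoid A \<Longrightarrow> x + y \<in> generated_submonoid A"
  unfolding generated_submonoid_def by blast+

lemma maximal_ideal_pos:
  assumes "numerical_semigroup S" "x \<in> maximal_ideal S"
  shows "0 < x"
proof -
  have "x \<in> \<nat>" "x \<noteq> 0"
    using assms by (auto simp: numerical_semigroup_def maximal_ideal_def)
  then show ?thesis by (auto elim: Nats_cases)
qed

lemma maximal_ideal_add:
  assumes "numerical_semigroup S" "x \<in> maximal_ideal S" "y \<in> maximal_ideal S"
  shows "x + y \<in> maximal_ideal S"
  using assms maximal_ideal_pos[OF assms(1,2)] maximal_ideal_pos[OF assms(1,3)]
  by (auto simp: numerical_semigroup_def maximal_ideal_def)

text \<open>Deleting an irreducible element from \<open>S\<close> leaves a submonoid.\<close>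

lemma irreducibles_subset_generators:
  assumes S: "numerical_semigroup S" and gen: "generated_submonoid A = S"
  shows "maximal_ideal S - (maximal_ideal S + maximal_ideal S) \<subseteq> A"
proof
  fix x assume x: "x \<in> maximal_ideal S - (maximal_ideal S + maximal_ideal S)"
  show "x \<in> A"
  proof (rule ccontr)
    assume "x \<notin> A"
    have "generated_submonoid A \<subseteq> S - {x}"
    proof (rule generated_submonoid_least)
      show "A \<subseteq> S - {x}" using \<open>x \<notin> A\<close> gen generated_submonoid_superset[of A] by auto
      show "0 \<in> S - {x}" using x S by (auto simp: maximal_ideal_def numerical_semigroup_def)
      fix s t assume "s \<in> S - {x}" "t \<in> S - {x}"
      moreover have "s + t \<noteq> x"
      proof
        assume "s + t = x"
        then have "s \<in> maximal_ideal S" "t \<in> maximal_ideal S"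
          using calculation by (auto simp: maximal_ideal_def)
        then show False using x \<open>s + t = x\<close> by blast
      qed
      ultimately show "s + t \<in> S - {x}" using S by (auto simp: numerical_semigroup_def)
    qed
    then show False using x gen by (auto simp: maximal_ideal_def)
  qed
qed

lemma irreducibles_generate:
  assumes S: "numerical_semigroup S"
  shows "generated_submonoid (maximal_ideal S - (maximal_ideal S + maximal_ideal S)) = S"
    (is "?G = S")
proof
  show "?G \<subseteq> S"
    using S by (intro generated_submonoid_least)
      (auto simp: maximal_ideal_def numerical_semigroup_def)
  have "x \<in> S \<Longrightarrow> x \<in> ?G" for x
  proof (induction "nat x" arbitrary: x rule: less_induct)
    case less
    consider "x = 0" | "x \<in> maximal_ideal S - (maximal_ideal S + maximal_ideal S)"
      | "x \<in> maximal_ideal S + maximal_ideal S"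
      using less.prems by (auto simp: maximal_ideal_def)
    then show ?case
    proof cases
      case 1
      then show ?thesis using generated_submonoid_zero by simp
    next
      case 2
      then show ?thesis using generated_submonoid_superset by blast
    next
      case 3
      then obtain s t where st: "s \<in> maximal_ideal S" "t \<in> maximal_ideal S" "x = s + t"
        by (auto elim: set_plus_elim)
      then have "0 < s" "0 < t" using maximal_ideal_pos[OF S] by auto
      then have "s \<in> ?G" "t \<in> ?G"
        using less.hyps st by (auto simp: maximal_ideal_def)
      then show ?thesis using generated_submonoid_add st(3) by blast
    qed
  qed
  then show "S \<subseteq> ?G" by blast
qed

lemma minimal_generators_eq:
  assumes S: "numerical_semigroup S"
  shows "minimal_generators S = maximal_ideal S - (maximal_ideal S + maximal_ideal S)"
  unfolding minimal_generators_def minimal_generating_system_def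
proof (rule the_equality, intro conjI allI impI)
  fix B assume "B \<subset> maximal_ideal S - (maximal_ideal S + maximal_ideal S)"
  then show "generated_submonoid B \<noteq> S"
    using irreducibles_subset_generators[OF S] by blast
next
  fix A assume "generated_submonoid A = S \<and> (\<forall>B\<subset>A. generated_submonoid B \<noteq> S)"
  then show "A = maximal_ideal S - (maximal_ideal S + maximal_ideal S)"
    using irreducibles_subset_generators[OF S] irreducibles_generate[OF S] by (metis psubsetI)
qed (rule irreducibles_generate[OF S])


section \<open>A translation-invariant criterion\<close>

text \<open>
  For \<open>M = M(S)\<close> and \<open>S \<noteq> \<nat>\<close>, these are the nonzero \<open>x \<in> S\<close> with \<open>F(S) - x \<in> 2K\<close>; in
  terms of \<open>K\<close>, the \<open>x \<in> M\<close> with \<open>x + K \<not>\<subseteq> M\<close>. The formula is in terms of \<open>M\<close> alone because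
  \<open>M\<close>, unlike \<open>S\<close> and \<open>K\<close>, is translated by a dilatation.
\<close>

definition gap_pair_elements :: "int set \<Rightarrow> int set" where
  "gap_pair_elements M = {x \<in> M. \<exists>u v. u \<notin> M \<and> v \<notin> M \<and> u + v = frobenius M + x}"

definition separated :: "int set \<Rightarrow> bool" where
  "separated M \<longleftrightarrow>
     (\<forall>x\<in>gap_pair_elements M. \<forall>y\<in>gap_pair_elements M. x - y \<in> ideal_diff M M \<longrightarrow> x = y)"

text \<open>
  An element of \<open>gap_pair_elements\<close> is tied to a pair of gaps; a summand taken from the element
  can be taken from either gap.
\<close>

lemma gap_pair_elements_summand:
  assumes S: "numerical_semigroup S"
    and "m \<in> maximal_ideal S" "n \<in> maximal_ideal S"
    and "m + n \<in> gap_pair_elements (maximal_ideal S)"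
  shows "m \<in> gap_pair_elements (maximal_ideal S)"
proof -
  obtain u v where uv: "u \<notin> maximal_ideal S" "v \<notin> maximal_ideal S"
      "u + v = frobenius (maximal_ideal S) + (m + n)"
    using assms(4) by (auto simp: gap_pair_elements_def)
  have "v - n \<notin> maximal_ideal S"
    using uv(2) maximal_ideal_add[OF S, of "v - n" n] assms(3) by auto
  moreover have "u + (v - n) = frobenius (maximal_ideal S) + m" using uv(3) by simp
  ultimately show ?thesis using uv(1) assms(2) unfolding gap_pair_elements_def by blast
qed

lemma finite_gap_pair_elements:
  assumes S: "numerical_semigroup S"
  shows "finite (gap_pair_elements (maximal_ideal S))"
proof (rule finite_subset)
  show "gap_pair_elements (maximal_ideal S) \<subseteq> {0..frobenius (maximal_ideal S)}"
  proof
    fix x assume "x \<in> gap_pair_elements (maximal_ideal S)"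
    then obtain u v where x: "x \<in> maximal_ideal S" and uv: "u \<notin> maximal_ideal S"
        "v \<notin> maximal_ideal S" "u + v = frobenius (maximal_ideal S) + x"
      by (auto simp: gap_pair_elements_def)
    have "u \<le> frobenius (maximal_ideal S)" "v \<le> frobenius (maximal_ideal S)"
      using gap_le_frobenius[OF has_last_gap_maximal_ideal[OF S]] uv(1,2) by auto
    then show "x \<in> {0..frobenius (maximal_ideal S)}"
      using uv(3) maximal_ideal_pos[OF S x] by simp
  qed
qed simp

text \<open>
  The reflection \<open>x \<mapsto> F - x\<close> exchanges \<open>K\<close> with the gaps of \<open>S\<close> (negative integers included)
  and the nonnegative integers outside \<open>K\<close> with the elements of \<open>S\<close> up to \<open>F\<close>.
\<close>

lemma twice_canonical_ideal_diff:
  assumes S: "numerical_semigroup S"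
  shows "(canonical_ideal S + canonical_ideal S) - canonical_ideal S =
    (\<lambda>x. frobenius S - x) ` {x \<in> S. \<exists>u v. u \<notin> S \<and> v \<notin> S \<and> u + v = frobenius S + x}"
    (is "?L = ?R ` ?A")
proof
  show "?L \<subseteq> ?R ` ?A"
  proof
    fix z assume z: "z \<in> ?L"
    then obtain k l where kl: "k \<in> canonical_ideal S" "l \<in> canonical_ideal S" "z = k + l"
      by (auto elim: set_plus_elim)
    then have "frobenius S - z \<in> S"
      using z by (auto simp: canonical_ideal_def)
    moreover have "(frobenius S - k) + (frobenius S - l) = frobenius S + (frobenius S - z)"
      using kl(3) by simp
    ultimately have "frobenius S - z \<in> ?A"
      using kl(1,2) unfolding canonical_ideal_def by blast
    then show "z \<in> ?R ` ?A" by (rule rev_image_eqI) simp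
  qed
  show "?R ` ?A \<subseteq> ?L"
  proof clarify
    fix x u v assume x: "x \<in> S" and uv: "u \<notin> S" "v \<notin> S" "u + v = frobenius S + x"
    have "frobenius S - u \<in> canonical_ideal S" "frobenius S - v \<in> canonical_ideal S"
      using uv(1,2) gap_le_frobenius[OF has_last_gap_numerical_semigroup[OF S]]
      by (auto simp: canonical_ideal_def Nats_altdef1)
    moreover have "frobenius S - x = (frobenius S - u) + (frobenius S - v)" using uv(3) by simp
    ultimately have "frobenius S - x \<in> canonical_ideal S + canonical_ideal S"
      by (metis set_plus_intro)
    then show "frobenius S - x \<in> ?L" using x by (simp add: canonical_ideal_def)
  qed
qed

text \<open>
  A pair of gaps of \<open>M\<close> with sum \<open>F + x\<close>, where \<open>x > 0\<close>, cannot involve \<open>0\<close>, since \<open>F + x\<close> is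
  in \<open>M\<close>. The only difference between \<open>M\<close> and \<open>S\<close> is thus \<open>x = 0\<close>, which occurs as soon as
  anything does, because all of \<open>x\<close> can be taken from one of the gaps.
\<close>

lemma gap_pairs_semigroup:
  assumes S: "numerical_semigroup S" "S \<noteq> \<nat>"
  defines "A \<equiv> {x \<in> S. \<exists>u v. u \<notin> S \<and> v \<notin> S \<and> u + v = frobenius S + x}"
  shows "A - {0} = gap_pair_elements (maximal_ideal S)" and "A \<noteq> {} \<Longrightarrow> 0 \<in> A"
proof -
  have big: "frobenius S + x \<in> maximal_ideal S" if "x \<in> maximal_ideal S" for x
    using above_frobenius_in[OF has_last_gap_maximal_ideal[OF S(1)], of "frobenius S + x"]
      maximal_ideal_pos[OF S(1) that] by (simp add: frobenius_maximal_ideal[OF S])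
  show "A - {0} = gap_pair_elements (maximal_ideal S)"
  proof
    show "A - {0} \<subseteq> gap_pair_elements (maximal_ideal S)"
      by (auto simp: A_def gap_pair_elements_def frobenius_maximal_ideal[OF S])
        (auto simp: maximal_ideal_def)
    show "gap_pair_elements (maximal_ideal S) \<subseteq> A - {0}"
    proof
      fix x assume "x \<in> gap_pair_elements (maximal_ideal S)"
      then obtain u v where x: "x \<in> maximal_ideal S" and uv: "u \<notin> maximal_ideal S"
          "v \<notin> maximal_ideal S" "u + v = frobenius S + x"
        by (auto simp: gap_pair_elements_def frobenius_maximal_ideal[OF S])
      then have "u \<noteq> 0" "v \<noteq> 0" using big[OF x] by auto
      then have "u \<notin> S" "v \<notin> S" using uv by (auto simp: maximal_ideal_def)
      then show "x \<in> A - {0}" using x uv(3) by (auto simp: A_def maximal_ideal_def)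
    qed
  qed
  show "0 \<in> A" if "A \<noteq> {}"
  proof -
    obtain x u v where x: "x \<in> S" and uv: "u \<notin> S" "v \<notin> S" "u + v = frobenius S + x"
      using \<open>A \<noteq> {}\<close> by (auto simp: A_def)
    have "v - x \<notin> S"
    proof
      assume "v - x \<in> S"
      then have "(v - x) + x \<in> S" using S(1) x by (simp only: numerical_semigroup_def)
      then show False using uv(2) by simp
    qed
    moreover have "u + (v - x) = frobenius S + 0" using uv(3) by simp
    moreover have "0 \<in> S" using S(1) by (simp add: numerical_semigroup_def)
    ultimately show ?thesis using uv(1) unfolding A_def by blast
  qed
qed

lemma twice_canonical_ideal_eq_iff:
  assumes S: "numerical_semigroup S"
  shows "canonical_ideal S + canonical_ideal S = canonical_ideal S \<longleftrightarrow>
    (canonical_ideal S + canonical_ideal S) - canonical_ideal S = {}"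
proof -
  have "0 \<in> canonical_ideal S"
    using frobenius_notin[OF has_last_gap_numerical_semigroup[OF S]]
    by (simp add: canonical_ideal_def)
  then have "canonical_ideal S \<subseteq> canonical_ideal S + canonical_ideal S"
    by (metis set_zero_plus2)
  then show ?thesis by auto
qed

text \<open>
  If \<open>2K \<noteq> K\<close>, the reflection of \<open>2K \<setminus> K\<close> is \<open>E \<union> {0}\<close>, and \<open>0\<close> is not a minimal generator,
  so \<open>E\<close> is the only candidate for \<open>{x\<^sub>1, \<dots>, x\<^sub>r}\<close>. If \<open>2K = K\<close>, then \<open>E\<close> is empty and
  the conditions on it hold trivially.
\<close>

lemma GAS_iff_minimal_generators:
  assumes S: "numerical_semigroup S" "S \<noteq> \<nat>"
  defines "E \<equiv> gap_pair_elements (maximal_ideal S)"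
  shows "GAS S \<longleftrightarrow>
    E \<subseteq> minimal_generators S \<and> (\<forall>x\<in>E. \<forall>y\<in>E. x - y \<notin> pseudo_frobenius S)"
    (is "_ \<longleftrightarrow> ?good E")
proof -
  let ?F = "frobenius S"
  define A where "A = {x \<in> S. \<exists>u v. u \<notin> S \<and> v \<notin> S \<and> u + v = ?F + x}"
  have AE: "A - {0} = E" and A0: "A \<noteq> {} \<Longrightarrow> 0 \<in> A"
    using gap_pairs_semigroup[OF S] unfolding A_def E_def by auto
  have gen0: "0 \<notin> minimal_generators S"
    using minimal_generators_eq[OF S(1)] by (simp add: maximal_ideal_def)
  have inj: "(\<lambda>x. ?F - x) ` A = {?F - x | x. x \<in> X} \<union> {?F} \<longleftrightarrow> A = insert 0 X" for X
  proof -
    have "{?F - x | x. x \<in> X} \<union> {?F} = (\<lambda>x. ?F - x) ` insert 0 X" by auto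
    moreover have "inj (\<lambda>x. ?F - x)" by (rule injI) simp
    ultimately show ?thesis by (simp only: inj_image_eq_iff)
  qed
  have "GAS S \<longleftrightarrow> A = {} \<or> (\<exists>X. finite X \<and> ?good X \<and> A = insert 0 X)"
    using S(1) unfolding GAS_def Let_def twice_canonical_ideal_eq_iff[OF S(1)]
      twice_canonical_ideal_diff[OF S(1)] A_def[symmetric] inj by auto
  also have "\<dots> \<longleftrightarrow> ?good E"
  proof
    assume "A = {} \<or> (\<exists>X. finite X \<and> ?good X \<and> A = insert 0 X)"
    then show "?good E"
    proof
      assume "A = {}"
      then show ?thesis using AE by auto
    next
      assume "\<exists>X. finite X \<and> ?good X \<and> A = insert 0 X"
      then obtain X where X: "?good X" "A = insert 0 X" by blast
      moreover have "0 \<notin> X" using X(1) gen0 by auto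
      ultimately have "X = E" using AE by auto
      then show ?thesis using X by simp
    qed
  next
    assume good: "?good E"
    have "A = insert 0 E" if "A \<noteq> {}" using AE A0[OF that] by auto
    then show "A = {} \<or> (\<exists>X. finite X \<and> ?good X \<and> A = insert 0 X)"
      using good finite_gap_pair_elements[OF S(1)] unfolding E_def by blast
  qed
  finally show ?thesis .
qed

lemma maximal_ideal_subset_self_diff:
  assumes "numerical_semigroup S"
  shows "maximal_ideal S \<subseteq> ideal_diff (maximal_ideal S) (maximal_ideal S)"
  using maximal_ideal_add[OF assms] by (auto simp: ideal_diff_def elt_set_plus_def)

text \<open>
  Both conditions for GAS forbid certain nonzero elements of \<open>M - M\<close> as differences in
  \<open>E = gap_pair_elements M\<close>: the first those of \<open>M\<close>, the second the others. Conversely, if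
  \<open>x \<in> E\<close> were a sum \<open>m + n\<close> in \<open>2M\<close>, then \<open>m\<close> would be in \<open>E\<close> by
  \<open>gap_pair_elements_summand\<close>, at the forbidden difference \<open>n\<close> from \<open>x\<close>.
\<close>

lemma GAS_iff_separated_proper:
  assumes S: "numerical_semigroup S" "S \<noteq> \<nat>"
  shows "GAS S \<longleftrightarrow> separated (maximal_ideal S)"
proof -
  define M where "M = maximal_ideal S"
  define E where "E = gap_pair_elements M"
  have EM: "E \<subseteq> M" by (auto simp: E_def gap_pair_elements_def)
  have MD: "M \<subseteq> ideal_diff M M"
    using maximal_ideal_subset_self_diff[OF S(1)] by (simp add: M_def)
  have MS: "M = S - {0}" by (simp add: M_def maximal_ideal_def)
  have "E \<subseteq> M - (M + M) \<and> (\<forall>x\<in>E. \<forall>y\<in>E. x - y \<notin> pseudo_frobenius S) \<longleftrightarrow> separated M"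
  proof
    assume good: "E \<subseteq> M - (M + M) \<and> (\<forall>x\<in>E. \<forall>y\<in>E. x - y \<notin> pseudo_frobenius S)"
    have "x = y" if xy: "x \<in> E" "y \<in> E" and d: "x - y \<in> ideal_diff M M" for x y
    proof (rule ccontr)
      assume "x \<noteq> y"
      have "x - y \<in> ideal_diff S M"
        using d MS by (auto simp: ideal_diff_def)
      then have "x - y \<in> S"
        using good xy by (auto simp: pseudo_frobenius_def M_def)
      then have "x - y \<in> M" using \<open>x \<noteq> y\<close> MS by simp
      then have "y + (x - y) \<in> M + M" using xy(2) EM by (blast intro: set_plus_intro)
      then show False using good xy(1) by auto
    qed
    then show "separated M" unfolding separated_def E_def by blast
  next
    assume "separated M"
    then have sep: "x = y" if "x \<in> E" "y \<in> E" "x - y \<in> ideal_diff M M" for x y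
      using that unfolding separated_def E_def by blast
    have "x \<notin> M + M" if "x \<in> E" for x
    proof
      assume "x \<in> M + M"
      then obtain m n where mn: "m \<in> M" "n \<in> M" "x = m + n" by (auto elim: set_plus_elim)
      then have "m \<in> E"
        using gap_pair_elements_summand[OF S(1)] that unfolding E_def M_def by blast
      then have "x = m" using sep[OF that, of m] mn MD by auto
      then show False using mn MS by simp
    qed
    moreover have "x - y \<notin> pseudo_frobenius S" if xy: "x \<in> E" "y \<in> E" for x y
    proof
      assume pf: "x - y \<in> pseudo_frobenius S"
      then have "x \<noteq> y" using S(1) by (auto simp: pseudo_frobenius_def numerical_semigroup_def)
      have "x - y + m \<in> M" if "m \<in> M" for m
      proof -
        \<comment> \<open>A pseudo-Frobenius number only has to map \<open>M\<close> into \<open>S\<close>; were \<open>0\<close> attained,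
          the opposite difference \<open>y - x\<close> would be in \<open>M\<close>.\<close>
        have "x - y + m \<noteq> 0"
        proof
          assume "x - y + m = 0"
          then have "y - x = m" by simp
          then have "y = x" using sep[OF xy(2,1)] that MD by auto
          then show False using \<open>x \<noteq> y\<close> by simp
        qed
        moreover have "x - y + m \<in> S"
          using pf that by (auto simp: pseudo_frobenius_def ideal_diff_def M_def elt_set_plus_def)
        ultimately show ?thesis using MS by simp
      qed
      then have "x - y \<in> ideal_diff M M" by (auto simp: ideal_diff_def elt_set_plus_def)
      then show False using sep xy \<open>x \<noteq> y\<close> by blast
    qed
    ultimately show "E \<subseteq> M - (M + M) \<and> (\<forall>x\<in>E. \<forall>y\<in>E. x - y \<notin> pseudo_frobenius S)"
      using EM by blast
  qed
  then show ?thesis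
    using GAS_iff_minimal_generators[OF S] minimal_generators_eq[OF S(1)]
    unfolding E_def M_def by simp
qed

text \<open>
  The semigroup \<open>\<nat>\<close> needs its own argument because the last gaps of \<open>\<nat>\<close> and of its maximal
  ideal are \<open>-1\<close> and \<open>0\<close>. It does arise: the dilatation of \<open>{0, F + 1, F + 2, \<dots>}\<close> with respect
  to \<open>-F\<close> is \<open>\<nat>\<close>.
\<close>

theorem GAS_iff:
  assumes S: "numerical_semigroup S"
  shows "GAS S \<longleftrightarrow> separated (maximal_ideal S)"
proof (cases "S = \<nat>")
  case True
  have "frobenius S = -1"
    by (rule frobenius_eqI) (auto simp: True Nats_altdef1)
  then have "canonical_ideal S = \<nat>"
    by (auto simp: canonical_ideal_def True Nats_altdef1)
  moreover have "\<nat> + \<nat> = (\<nat> :: int set)"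
  proof
    show "\<nat> + \<nat> \<subseteq> (\<nat> :: int set)" by (auto elim!: set_plus_elim)
    show "(\<nat> :: int set) \<subseteq> \<nat> + \<nat>" by (rule set_zero_plus2) simp
  qed
  ultimately have "GAS S" using S by (simp add: GAS_def)
  have M: "maximal_ideal S = {0<..}"
    by (auto simp: maximal_ideal_def True Nats_altdef1)
  have "frobenius {0<..} = 0" by (rule frobenius_eqI) auto
  then have "gap_pair_elements (maximal_ideal S) = {}"
    unfolding gap_pair_elements_def M by (force simp only: greaterThan_iff)
  then show ?thesis using \<open>GAS S\<close> by (simp add: separated_def)
next
  case False
  then show ?thesis using GAS_iff_separated_proper S by blast
qed

lemma ideal_diff_translate: "ideal_diff (a +o X) (a +o Y) = ideal_diff X (Y :: int set)"
proof -
  have "z +o (a +o Y) = a +o (z +o Y)" for z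
    by (simp add: set_plus_rearrange2 add.commute)
  moreover have "a +o U \<subseteq> a +o V \<longleftrightarrow> U \<subseteq> V" for U V :: "int set"
    by (auto simp: elt_set_plus_def)
  ultimately show ?thesis by (simp add: ideal_diff_def)
qed

lemma gap_pair_elements_translate:
  assumes "has_last_gap M"
  shows "gap_pair_elements (a +o M) = a +o gap_pair_elements M"
proof -
  have mem: "z \<in> a +o N \<longleftrightarrow> z - a \<in> N" for z and N :: "int set"
    using set_plus_intro2[of "z - a" N a] by (auto simp: elt_set_plus_def)
  have "(\<exists>u v. u - a \<notin> M \<and> v - a \<notin> M \<and> u + v = a + frobenius M + x) \<longleftrightarrow>
      (\<exists>u v. u \<notin> M \<and> v \<notin> M \<and> u + v = frobenius M + (x - a))" (is "?L \<longleftrightarrow> ?R") for x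
  proof
    assume ?L
    then obtain u v where "u - a \<notin> M" "v - a \<notin> M" "u + v = a + frobenius M + x" by blast
    then show ?R by (intro exI[of _ "u - a"] exI[of _ "v - a"]) simp
  next
    assume ?R
    then obtain u v where "u \<notin> M" "v \<notin> M" "u + v = frobenius M + (x - a)" by blast
    then show ?L by (intro exI[of _ "u + a"] exI[of _ "v + a"]) simp
  qed
  then show ?thesis
    by (intro set_eqI) (simp add: gap_pair_elements_def mem frobenius_translate[OF assms])
qed

lemma separated_translate:
  assumes "has_last_gap M"
  shows "separated (a +o M) \<longleftrightarrow> separated M"
proof -
  have "(\<forall>x\<in>a +o N. P x) \<longleftrightarrow> (\<forall>x\<in>N. P (a + x))" for N and P :: "int \<Rightarrow> bool"
    by (auto simp: elt_set_plus_def)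
  then show ?thesis
    by (simp add: separated_def gap_pair_elements_translate[OF assms] ideal_diff_translate)
qed


section \<open>Dilatations\<close>

lemma maximal_ideal_dilatation:
  assumes "0 \<notin> a +o maximal_ideal S"
  shows "maximal_ideal (dilatation S a) = a +o maximal_ideal S"
  using assms by (auto simp: maximal_ideal_def dilatation_def elt_set_plus_def add.commute)

lemma numerical_semigroup_dilatation:
  assumes S: "numerical_semigroup S"
    and a: "a \<in> ideal_diff (maximal_ideal S) (maximal_ideal S + maximal_ideal S)"
  shows "numerical_semigroup (dilatation S a)"
proof -
  define M where "M = maximal_ideal S"
  have aMM: "m + n + a \<in> M" if "m \<in> M" "n \<in> M" for m n
  proof -
    have "a + (m + n) \<in> a +o (M + M)" using that by (intro set_plus_intro2 set_plus_intro)
    then show ?thesis using a by (auto simp: ideal_diff_def M_def add.commute)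
  qed
  have T: "dilatation S a = insert 0 {m + a | m. m \<in> M}"
    by (simp add: dilatation_def M_def)
  \<comment> \<open>Translation by \<open>m + a\<close> maps \<open>M\<close> into itself, so it does not lower \<open>Min M\<close>.\<close>
  have nonneg: "0 \<le> m + a" if m: "m \<in> M" for m
  proof (rule ccontr)
    assume neg: "\<not> 0 \<le> m + a"
    have "\<forall>n\<in>M. False"
    proof
      fix n assume "n \<in> M"
      then show False
      proof (induction "nat n" arbitrary: n rule: less_induct)
        case less
        have "n + (m + a) \<in> M" using aMM[OF less.prems m] by (simp add: add.assoc)
        moreover have "0 < n" using maximal_ideal_pos[OF S] less.prems by (simp add: M_def)
        then have "nat (n + (m + a)) < nat n" using neg by simp
        ultimately show False using less.hyps by blast
      qed
    qed
    then show False using m by blast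
  qed
  have "\<nat> - dilatation S a \<subseteq> {0..frobenius M + a}"
  proof
    fix x assume x: "x \<in> \<nat> - dilatation S a"
    then have "x - a \<notin> M" unfolding T by force
    then have "x - a \<le> frobenius M"
      using gap_le_frobenius has_last_gap_maximal_ideal[OF S] unfolding M_def by blast
    then show "x \<in> {0..frobenius M + a}" using x by (auto simp: Nats_altdef1)
  qed
  then have "finite (\<nat> - dilatation S a)" by (rule finite_subset) simp
  moreover have "x + y \<in> dilatation S a" if xy: "x \<in> dilatation S a" "y \<in> dilatation S a" for x y
  proof (cases "x = 0 \<or> y = 0")
    case True
    then show ?thesis using xy by auto
  next
    case False
    then obtain m n where "m \<in> M" "n \<in> M" "x = m + a" "y = n + a"
      using xy unfolding T by auto
    moreover from this have "x + y = (m + n + a) + a" by simp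
    ultimately show ?thesis using aMM unfolding T by blast
  qed
  moreover have "dilatation S a \<subseteq> \<nat>"
    using nonneg unfolding T by (auto simp: Nats_altdef1)
  ultimately show ?thesis by (simp add: numerical_semigroup_def T)
qed

theorem proposition4p9:
  fixes S :: "int set" and a :: int
  assumes "numerical_semigroup S" and "S \<noteq> \<nat>"
    and "a \<in> ideal_diff (maximal_ideal S) (maximal_ideal S + maximal_ideal S)"
    and "0 \<notin> {m + a | m. m \<in> maximal_ideal S}"
  shows "GAS (dilatation S a) \<longleftrightarrow> GAS S"
proof -
  have "0 \<notin> a +o maximal_ideal S"
    using assms(4) by (auto simp: elt_set_plus_def add.commute)
  then have "maximal_ideal (dilatation S a) = a +o maximal_ideal S"
    by (rule maximal_ideal_dilatation)
  then show ?thesis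
    using GAS_iff[OF numerical_semigroup_dilatation[OF assms(1,3)]] GAS_iff[OF assms(1)]
      separated_translate[OF has_last_gap_maximal_ideal[OF assms(1)]] by simp
qed

end
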